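(* Let $1<s<r$ be integers. For every $\varepsilon>0$ there is a constant $c>0$ such that for every sufficiently large $n$ divisible by $r$ there is an $n$-vertex graph $G$ with minimum degree at least $\left(1-\frac{s}{r}\right)n$ such that, for $p = c\,p_s(n)$, the probability that $G\cup G_{n,p}$ contains a $K_r$-factor is less than $\varepsilon$. Here \[ p_s(n) = \begin{cases} \frac{\log n}{n} & \text{if } s=2,\\ n^{-\varphi(s)} & \text{if } s \geq 3,\end{cases} \qquad \varphi(s) = \frac{2s}{(s-1)(s+2)}. \]
   Context: $G_{n,p}$ is the binomial random graph on the vertex set of $G$ with edge probability $p$, and $G\cup G_{n,p}$ is the union of edge sets. A $K_r$-factor is a collection of vertex-disjoint copies of $K_r$ covering all vertices. *)

theory Defs
  imports "HOL-Probability.Probability"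
begin

text \<open>
  A simple graph is given by a vertex set \<open>V\<close> and an edge set \<open>E\<close> consisting of
  two-element subsets of \<open>V\<close>.
\<close>

definition all_edges :: "'a set \<Rightarrow> 'a set set" where
  "all_edges V = {e. e \<subseteq> V \<and> card e = 2}"

definition simple_graph :: "'a set \<Rightarrow> 'a set set \<Rightarrow> bool" where
  "simple_graph V E \<longleftrightarrow> finite V \<and> E \<subseteq> all_edges V"

definition degree :: "'a set set \<Rightarrow> 'a \<Rightarrow> nat" where
  "degree E v = card {e \<in> E. v \<in> e}"

text \<open>Only meaningful for finite nonempty \<open>V\<close>, because of \<open>Min\<close>.\<close>

definition min_degree :: "'a set \<Rightarrow> 'a set set \<Rightarrow> nat" where
  "min_degree V E = Min (degree E ` V)"

text \<open>A copy of the complete graph on \<open>r\<close> vertices is represented by its vertex set.\<close>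

definition clique_copy :: "'a set \<Rightarrow> 'a set set \<Rightarrow> nat \<Rightarrow> 'a set \<Rightarrow> bool" where
  "clique_copy V E r C \<longleftrightarrow> C \<subseteq> V \<and> card C = r \<and> all_edges C \<subseteq> E"

definition has_clique_factor :: "'a set \<Rightarrow> 'a set set \<Rightarrow> nat \<Rightarrow> bool" where
  "has_clique_factor V E r \<longleftrightarrow>
     (\<exists>F. (\<forall>C\<in>F. clique_copy V E r C) \<and> disjoint F \<and> \<Union>F = V)"

text \<open>
  The distribution of the edge set of the binomial random graph: every pair of vertices is
  independently an edge with probability \<open>p\<close>. Note that \<open>bernoulli_pmf p\<close> truncates \<open>p\<close>
  to the unit interval.
\<close>

definition binomial_random_graph :: "'a set \<Rightarrow> real \<Rightarrow> 'a set set pmf" where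
  "binomial_random_graph V p =
     map_pmf (\<lambda>f. {e \<in> all_edges V. f e}) (Pi_pmf (all_edges V) False (\<lambda>_. bernoulli_pmf p))"

definition varphi :: "nat \<Rightarrow> real" where
  "varphi s = 2 * real s / ((real s - 1) * (real s + 2))"

text \<open>Only used for \<open>s \<ge> 2\<close>.\<close>

definition p_fun :: "nat \<Rightarrow> nat \<Rightarrow> real" where
  "p_fun s n = (if s = 2 then ln (real n) / real n else real n powr (- varphi s))"

end

theory Submission
  imports Defs "HOL-Real_Asymp.Real_Asymp"
begin

text \<open>
  Let \<open>A\<close> be a set of \<open>s n / r + t\<close> vertices, and let \<open>G\<close> consist of all pairs not inside \<open>A\<close> together
  with a graph \<open>H\<close> of minimum degree at least \<open>t\<close> on \<open>A\<close>. The members of a \<open>K\<^sub>r\<close>-factor meet \<open>A\<close> in \<open>s\<close>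
  vertices on average, up to a total excess of \<open>t\<close>, and a member that contains an isolated vertex of
  \<open>A\<close> meets \<open>A\<close> in only one vertex. Hence \<open>A\<close> must contain at least \<open>t\<close> plus the number of its
  isolated vertices many copies of \<open>K\<^sub>s\<^sub>+\<^sub>1\<close>.

  For \<open>s \<ge> 3\<close> take \<open>t\<close> about \<open>n p\<close> and \<open>H\<close> random of density \<open>O(p)\<close>. The expected number of
  copies of \<open>K\<^sub>s\<^sub>+\<^sub>1\<close> in \<open>A\<close> is then \<open>O(n\<^bsup>s+1\<^esup> p\<^bsup>K\<^esup>)\<close> with \<open>K = s (s + 1) / 2\<close>. The exponent
  \<open>\<phi>(s) = s / (K - 1)\<close> makes this \<open>O(c\<^bsup>K-1\<^esup> t)\<close>, so Markov's inequality suffices. For \<open>s = 2\<close> take \<open>t = 0\<close>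
  and \<open>H\<close> empty: for small \<open>c\<close> there are polynomially many isolated vertices in \<open>A\<close> by
  Chebyshev's inequality, but only polylogarithmically many triangles.
\<close>

section \<open>Edges of complete graphs\<close>

lemma finite_all_edges: "finite V \<Longrightarrow> finite (all_edges V)"
  by (rule finite_subset[of _ "Pow V"]) (auto simp: all_edges_def)

lemma all_edges_mono: "A \<subseteq> B \<Longrightarrow> all_edges A \<subseteq> all_edges B"
  by (auto simp: all_edges_def)

lemma card_all_edges: "finite V \<Longrightarrow> card (all_edges V) = card V choose 2"
  unfolding all_edges_def by (rule n_subsets)

lemma card_incident_edges:
  assumes "finite A" "v \<in> A"
  shows "card {e \<in> all_edges A. v \<in> e} = card A - 1"
proof -
  have "{e \<in> all_edges A. v \<in> e} = (\<lambda>u. {v, u}) ` (A - {v})"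
    using assms(2) by (auto simp: all_edges_def card_2_iff)
  moreover have "inj_on (\<lambda>u. {v, u}) (A - {v})"
    by (auto simp: inj_on_def doubleton_eq_iff)
  ultimately show ?thesis using assms by (simp add: card_image)
qed

subsection \<open>Cliques and isolated vertices in a part\<close>

text \<open>Edges leaving \<open>A\<close> are disregarded: a clique through a vertex isolated
  within \<open>A\<close> has no second vertex in \<open>A\<close>, whatever its edges
  outside.\<close>

definition isolated :: "'a set \<Rightarrow> 'a set set \<Rightarrow> 'a set" where
  "isolated A E = {v \<in> A. \<forall>e \<in> all_edges A. v \<in> e \<longrightarrow> e \<notin> E}"

definition cliques :: "'a set \<Rightarrow> 'a set set \<Rightarrow> nat \<Rightarrow> 'a set set" where
  "cliques A E j = {S. clique_copy A E j S}"

text \<open>By Pascal's rule, each step from \<open>a \<ge> s\<close> to \<open>Suc a\<close> adds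
  \<open>a choose s\<close>, which is at least 1.\<close>

lemma diff_le_binomial_Suc:
  fixes a s :: nat
  assumes "0 < s"
  shows "a - s \<le> a choose Suc s"
proof (induction a)
  case (Suc a)
  show ?case
  proof (cases "s \<le> a")
    case True
    then have "a choose s > 0" by (simp add: zero_less_binomial)
    then show ?thesis using Suc True unfolding binomial_Suc_Suc by linarith
  qed (use Suc in auto)
qed auto

text \<open>Double counting over the \<open>k\<close> members of the factor: a local inequality for
  each member is summed, and the \<open>Suc s\<close>-subsets counted for different members are
  distinct cliques.\<close>

lemma clique_factor_excess:
  assumes fin: "finite V" and AV: "A \<subseteq> V" and fac: "has_clique_factor V E r"
    and cV: "card V = r * k" and r: "0 < r" and cA: "card A = s * k + t" and s: "2 \<le> s"
  shows "t + card (isolated A E) \<le> card (cliques A E (Suc s))"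
proof -
  obtain F where F: "\<And>C. C \<in> F \<Longrightarrow> clique_copy V E r C" "disjoint F" "\<Union>F = V"
    using fac unfolding has_clique_factor_def by blast
  have sub: "C \<subseteq> V" "card C = r" "all_edges C \<subseteq> E" "finite C" if "C \<in> F" for C
    using F(1)[OF that] fin by (auto simp: clique_copy_def intro: finite_subset)
  have finF: "finite F" using F(3) fin by (metis finite_UnionD)
  have finA: "finite A" using AV fin finite_subset by blast
  have disj: "C \<inter> D = {}" if "C \<in> F" "D \<in> F" "C \<noteq> D" for C D
    using F(2) that by (auto dest: disjointD)
  have "card V = (\<Sum>C\<in>F. card C)"
    unfolding F(3)[symmetric]
    by (rule card_Union_disjoint) (use F(2) sub in auto)
  then have cF: "card F = k" using sub cV r by (simp add: mult.commute)
  define I where "I = isolated A E"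
  have IA: "I \<subseteq> A" by (auto simp: I_def isolated_def)
  have split: "card X = (\<Sum>C\<in>F. card (X \<inter> C))" if "X \<subseteq> A" for X
  proof -
    have "X = (\<Union>C\<in>F. X \<inter> C)" using that AV F(3) by auto
    then have "card X = card (\<Union>C\<in>F. X \<inter> C)" by simp
    also have "\<dots> = (\<Sum>C\<in>F. card (X \<inter> C))"
    proof (rule card_UN_disjoint)
      show "\<forall>C\<in>F. finite (X \<inter> C)" using sub(4) by simp
      show "\<forall>C\<in>F. \<forall>D\<in>F. C \<noteq> D \<longrightarrow> X \<inter> C \<inter> (X \<inter> D) = {}" using disj by blast
    qed (fact finF)
    finally show ?thesis .
  qed
  define Q where "Q C = {S. S \<subseteq> A \<inter> C \<and> card S = Suc s}" for C
  have cQ: "card (Q C) = card (A \<inter> C) choose Suc s" for C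
    unfolding Q_def by (rule n_subsets) (use finA in auto)
  \<comment> \<open>A member that avoids \<open>I\<close> contributes at least
    \<open>card (A \<inter> C) - s\<close> sets to \<open>Q C\<close>. A member that meets
    \<open>I\<close> has a single vertex in \<open>A\<close>, so the left side is 2, which is at
    most \<open>s\<close>.\<close>
  have key: "card (A \<inter> C) + card (I \<inter> C) \<le> card (Q C) + s" if C: "C \<in> F" for C
  proof (cases "I \<inter> C = {}")
    case True
    have "card (A \<inter> C) - s \<le> card (Q C)" using cQ diff_le_binomial_Suc[of s] s by simp
    then show ?thesis using True by simp
  next
    case False
    then obtain v where v: "v \<in> I" "v \<in> C" by auto
    have "u = v" if u: "u \<in> A \<inter> C" for u
    proof (rule ccontr)
      assume "u \<noteq> v"
      then have "{u, v} \<in> all_edges C" "{u, v} \<in> all_edges A"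
        using u v IA by (auto simp: all_edges_def)
      then show False using v(1) sub(3)[OF C] unfolding I_def isolated_def by blast
    qed
    then have "A \<inter> C = {v}" "I \<inter> C = {v}" using v IA by auto
    then show ?thesis using s by simp
  qed
  have "card A + card I = (\<Sum>C\<in>F. card (A \<inter> C) + card (I \<inter> C))"
    using split[of A] split[of I] IA by (simp add: sum.distrib)
  also have "\<dots> \<le> (\<Sum>C\<in>F. card (Q C) + s)" by (intro sum_mono key)
  also have "\<dots> = (\<Sum>C\<in>F. card (Q C)) + s * k" using cF by (simp add: sum.distrib)
  also have "(\<Sum>C\<in>F. card (Q C)) = card (\<Union>C\<in>F. Q C)"
  proof (rule card_UN_disjoint[symmetric])
    show "\<forall>C\<in>F. finite (Q C)" unfolding Q_def using finA by auto
    show "\<forall>C\<in>F. \<forall>D\<in>F. C \<noteq> D \<longrightarrow> Q C \<inter> Q D = {}"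
    proof (intro ballI impI)
      fix C D assume CD: "C \<in> F" "D \<in> F" "C \<noteq> D"
      have "S = {}" if "S \<in> Q C" "S \<in> Q D" for S
        using that disj[OF CD] unfolding Q_def by auto
      moreover have "{} \<notin> Q C" by (simp add: Q_def)
      ultimately show "Q C \<inter> Q D = {}" by blast
    qed
  qed (fact finF)
  also have "card (\<Union>C\<in>F. Q C) \<le> card (cliques A E (Suc s))"
  proof (rule card_mono)
    show "finite (cliques A E (Suc s))"
      by (rule finite_subset[of _ "Pow A"]) (auto simp: cliques_def clique_copy_def finA)
    show "(\<Union>C\<in>F. Q C) \<subseteq> cliques A E (Suc s)"
    proof (rule UN_least, rule subsetI)
      fix C S assume C: "C \<in> F" and S: "S \<in> Q C"
      then have "all_edges S \<subseteq> all_edges C" by (auto simp: Q_def all_edges_def)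
      then show "S \<in> cliques A E (Suc s)"
        using sub(3)[OF C] S by (auto simp: Q_def cliques_def clique_copy_def)
    qed
  qed
  finally show ?thesis using cA unfolding I_def by simp
qed

subsection \<open>The binomial random graph\<close>

lemma expectation_card:
  assumes "finite I"
  shows "measure_pmf.expectation M (\<lambda>x. real (card {i \<in> I. P i x})) =
    (\<Sum>i\<in>I. measure_pmf.prob M {x. P i x})"
proof -
  have "real (card {i \<in> I. P i x}) = (\<Sum>i\<in>I. indicator {x. P i x} x)" for x
  proof -
    have "real (card {i \<in> I. P i x}) = (\<Sum>i\<in>{i \<in> I. P i x}. 1)" by simp
    also have "\<dots> = (\<Sum>i\<in>I. indicator {x. P i x} x)"
      using assms by (intro sum.mono_neutral_cong_left) auto
    finally show ?thesis .
  qed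
  moreover have "integrable (measure_pmf M) (indicator {x. P i x} :: _ \<Rightarrow> real)" for i
    by (rule measure_pmf.integrable_const_bound[where B = 1]) auto
  ultimately show ?thesis
    by (simp add: Bochner_Integration.integral_sum)
qed

lemma prob_card_ge_le:
  assumes "finite I" "0 < a"
  shows "measure_pmf.prob M {x. a \<le> real (card {i \<in> I. P i x})}
    \<le> (\<Sum>i\<in>I. measure_pmf.prob M {x. P i x}) / a"
proof -
  have "integrable (measure_pmf M) (\<lambda>x. real (card {i \<in> I. P i x}))"
    by (rule measure_pmf.integrable_const_bound[where B = "real (card I)"])
       (auto intro: card_mono assms)
  from integral_Markov_inequality_measure[OF this, of "UNIV" a]
  show ?thesis using assms(2) unfolding expectation_card[OF assms(1)] 
    by simp
qed

text \<open>Only an inequality, since \<open>p\<close> may exceed 1, where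
  \<open>bernoulli_pmf\<close> truncates it.\<close>

lemma prob_binomial_random_graph_superset_le:
  assumes "finite V" "0 \<le> p" "D \<subseteq> all_edges V"
  shows "measure_pmf.prob (binomial_random_graph V p) {R. D \<subseteq> R} \<le> p ^ card D"
proof -
  have fin: "finite (all_edges V)" by (rule finite_all_edges) fact
  have "(\<lambda>f. {e \<in> all_edges V. f e}) -` {R. D \<subseteq> R} =
      Pi (all_edges V) (\<lambda>e. if e \<in> D then {True} else UNIV)"
    using assms(3) by (auto simp: Pi_iff split: if_splits)
  then have "measure_pmf.prob (binomial_random_graph V p) {R. D \<subseteq> R} =
     (\<Prod>e\<in>all_edges V. measure_pmf.prob (bernoulli_pmf p) (if e \<in> D then {True} else UNIV))"
    unfolding binomial_random_graph_def by (simp add: measure_Pi_pmf_Pi[OF fin])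
  also have "\<dots> = (\<Prod>e\<in>D. measure_pmf.prob (bernoulli_pmf p) {True})"
    by (rule prod.mono_neutral_cong_right[OF fin assms(3)]) auto
  also have "\<dots> = (measure_pmf.prob (bernoulli_pmf p) {True}) ^ card D" by simp
  also have "\<dots> \<le> p ^ card D"
    by (rule power_mono) (use assms(2) in \<open>auto simp: measure_pmf_single bernoulli_pmf.rep_eq\<close>)
  finally show ?thesis .
qed

text \<open>An equality, because the mean number of isolated vertices has to be known exactly for
  the variance.\<close>

lemma prob_binomial_random_graph_disjoint:
  assumes "finite V" "0 \<le> p" "p \<le> 1" "D \<subseteq> all_edges V"
  shows "measure_pmf.prob (binomial_random_graph V p) {R. \<forall>e\<in>D. e \<notin> R} = (1 - p) ^ card D"
proof -
  have fin: "finite (all_edges V)" by (rule finite_all_edges) fact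
  have "(\<lambda>f. {e \<in> all_edges V. f e}) -` {R. \<forall>e\<in>D. e \<notin> R} =
      Pi (all_edges V) (\<lambda>e. if e \<in> D then {False} else UNIV)"
    using assms(4) by (auto simp: Pi_iff split: if_splits)
  then have "measure_pmf.prob (binomial_random_graph V p) {R. \<forall>e\<in>D. e \<notin> R} =
     (\<Prod>e\<in>all_edges V. measure_pmf.prob (bernoulli_pmf p) (if e \<in> D then {False} else UNIV))"
    unfolding binomial_random_graph_def by (simp add: measure_Pi_pmf_Pi[OF fin])
  also have "\<dots> = (\<Prod>e\<in>D. measure_pmf.prob (bernoulli_pmf p) {False})"
    by (rule prod.mono_neutral_cong_right[OF fin assms(4)]) auto
  also have "\<dots> = (1 - p) ^ card D" using assms(2,3) by (simp add: measure_pmf_single)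
  finally show ?thesis .
qed

subsection \<open>A random graph with deterministic minimum degree\<close>

text \<open>The vertices below \<open>Suc t * m\<close> form blocks of \<open>m\<close> consecutive numbers. In each block
  \<open>i \<le> t\<close> every vertex \<open>u\<close> picks the neighbour at offset \<open>f (u, i)\<close>. So the minimum degree is at least
  \<open>t\<close> for every \<open>f\<close> (one pick may be \<open>u\<close> itself), which saves a concentration argument.\<close>

definition pick_graph :: "nat \<Rightarrow> nat \<Rightarrow> nat \<Rightarrow> (nat \<times> nat \<Rightarrow> nat) \<Rightarrow> nat set set" where
  "pick_graph N t m f =
     {{u, v} | u v. u < N \<and> v < N \<and> u \<noteq> v \<and> v div m \<le> t \<and> f (u, v div m) = v mod m}"

definition pick_pmf :: "nat \<Rightarrow> nat \<Rightarrow> nat \<Rightarrow> (nat \<times> nat \<Rightarrow> nat) pmf" where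
  "pick_pmf N t m = Pi_pmf ({..<N} \<times> {..t}) 0 (\<lambda>_. pmf_of_set {..<m})"

lemma pick_graph_subset: "pick_graph N t m f \<subseteq> all_edges {..<N}"
  by (auto simp: pick_graph_def all_edges_def)

lemma degree_pick_graph:
  assumes f: "\<And>i. i \<le> t \<Longrightarrow> f (u, i) < m" and N: "Suc t * m \<le> N" and u: "u < N"
  shows "t \<le> degree (pick_graph N t m f) u"
proof -
  define g where "g i = i * m + f (u, i)" for i
  have g: "g i div m = i" "g i mod m = f (u, i)" "g i < N" if "i \<le> t" for i
  proof -
    show "g i div m = i" "g i mod m = f (u, i)" using f[OF that] by (auto simp: g_def)
    have "g i < Suc i * m" using f[OF that] by (simp add: g_def)
    also have "\<dots> \<le> Suc t * m" using that by (intro mult_le_mono1) simp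
    finally show "g i < N" using N by simp
  qed
  define J where "J = {i. i \<le> t \<and> g i \<noteq> u}"
  \<comment> \<open>\<open>g i = u\<close> forces \<open>i = u div m\<close>, so at most one of the
    \<open>t + 1\<close> picks is lost.\<close>
  have "{..t} \<subseteq> insert (u div m) J" using g(1) by (auto simp: J_def)
  then have "card {..t} \<le> card (insert (u div m) J)"
    by (rule card_mono[rotated]) (simp add: J_def)
  also have "\<dots> \<le> Suc (card J)" by (rule card_insert_le_m1) auto
  finally have "t \<le> card J" by simp
  also have "card J = card ((\<lambda>i. {u, g i}) ` J)"
  proof (rule card_image[symmetric], rule inj_onI)
    fix i j assume "i \<in> J" "j \<in> J" "{u, g i} = {u, g j}"
    then show "i = j" using g(1) unfolding J_def doubleton_eq_iff by (metis mem_Collect_eq)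
  qed
  also have "\<dots> \<le> card {e \<in> pick_graph N t m f. u \<in> e}"
  proof (rule card_mono)
    have "finite (pick_graph N t m f)"
      using finite_subset[OF pick_graph_subset finite_all_edges] by blast
    then show "finite {e \<in> pick_graph N t m f. u \<in> e}" by simp
    show "(\<lambda>i. {u, g i}) ` J \<subseteq> {e \<in> pick_graph N t m f. u \<in> e}"
    proof (rule image_subsetI)
      fix i assume "i \<in> J"
      then have "i \<le> t" "u \<noteq> g i" by (auto simp: J_def)
      then have "{u, g i} \<in> pick_graph N t m f"
        using g[of i] u unfolding pick_graph_def
        by (intro CollectI exI[of _ u] exI[of _ "g i"]) simp
      then show "{u, g i} \<in> {e \<in> pick_graph N t m f. u \<in> e}" by simp
    qed
  qed
  finally show ?thesis unfolding degree_def .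
qed

lemma set_pmf_pick_pmf:
  assumes "f \<in> set_pmf (pick_pmf N t m)" "0 < m" "u < N" "i \<le> t"
  shows "f (u, i) < m"
proof -
  have "set_pmf (pmf_of_set {..<m}) = {..<m}"
    using assms(2) by (intro set_pmf_of_set) auto
  then show ?thesis
    using assms unfolding pick_pmf_def by (auto simp: set_Pi_pmf PiE_dflt_def)
qed

text \<open>Finite support makes every real function of the picks integrable.\<close>

lemma finite_set_pick_pmf: "0 < m \<Longrightarrow> finite (set_pmf (pick_pmf N t m))"
  unfolding pick_pmf_def
  by (subst set_Pi_pmf) (auto intro!: finite_PiE_dflt simp: set_pmf_of_set[of "{..<m}"] lessThan_empty_iff)

text \<open>Distinct keys read independent picks. Each prescribed value has probability
  \<open>1 / m\<close>, or 0 if it is not below \<open>m\<close>.\<close>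

lemma prob_pick_pmf_values_le:
  assumes m: "0 < m" and inj: "inj_on key D" and key: "key ` D \<subseteq> {..<N} \<times> {..t}"
  shows "measure_pmf.prob (pick_pmf N t m) {f. \<forall>e\<in>D. f (key e) = val e} \<le> (1 / real m) ^ card D"
proof -
  let ?I = "{..<N} \<times> {..t}"
  define B where "B x = (if x \<in> key ` D then {val (the_inv_into D key x)} else UNIV)" for x
  have "f \<in> Pi ?I B \<longleftrightarrow> (\<forall>x\<in>key ` D. f x \<in> B x)" for f
    using key unfolding Pi_iff B_def by (metis (mono_tags, lifting) UNIV_I subsetD)
  then have "{f. \<forall>e\<in>D. f (key e) = val e} = Pi ?I B"
    using inj by (auto simp: B_def the_inv_into_f_f)
  then have "measure_pmf.prob (pick_pmf N t m) {f. \<forall>e\<in>D. f (key e) = val e} =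
      (\<Prod>x\<in>?I. measure_pmf.prob (pmf_of_set {..<m}) (B x))"
    unfolding pick_pmf_def by (simp add: measure_Pi_pmf_Pi)
  also have "\<dots> = (\<Prod>x\<in>key ` D. measure_pmf.prob (pmf_of_set {..<m}) (B x))"
    by (rule prod.mono_neutral_right) (use key in \<open>auto simp: B_def\<close>)
  also have "\<dots> \<le> (\<Prod>x\<in>key ` D. 1 / real m)"
  proof (rule prod_mono)
    fix x assume "x \<in> key ` D"
    then obtain a where "B x = {a}" by (simp add: B_def)
    moreover have "{..<m} \<noteq> {}" using m by auto
    ultimately show "0 \<le> measure_pmf.prob (pmf_of_set {..<m}) (B x) \<and>
        measure_pmf.prob (pmf_of_set {..<m}) (B x) \<le> 1 / real m"
      by (auto simp: measure_pmf_single pmf_of_set indicator_def)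
  qed
  also have "\<dots> = (1 / real m) ^ card D" using inj by (simp add: card_image)
  finally show ?thesis .
qed

lemma all_edgesE:
  fixes e :: "'a :: linorder set"
  assumes "e \<in> all_edges V"
  shows "Min e \<in> V" "Max e \<in> V" "Min e \<noteq> Max e" "e = {Min e, Max e}"
proof -
  obtain u v where uv: "e = {u, v}" "u \<noteq> v" "u \<in> V" "v \<in> V"
    using assms by (auto simp: all_edges_def card_2_iff)
  then show "Min e \<in> V" "Max e \<in> V" "Min e \<noteq> Max e" "e = {Min e, Max e}"
    by (auto simp: min_def max_def)
qed

text \<open>A set of edges is picked in one of its orientations. For a fixed orientation, either the arcs
  use distinct picks, or two of them demand different values of the same pick.\<close>

lemma prob_pick_graph_superset_le:
  assumes m: "0 < m" and D: "D \<subseteq> all_edges {..<N}"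
  shows "measure_pmf.prob (pick_pmf N t m) {f. D \<subseteq> pick_graph N t m f} \<le> (2 / real m) ^ card D"
proof -
  let ?P = "measure_pmf.prob (pick_pmf N t m)"
  have finD: "finite D" using D finite_subset[OF _ finite_all_edges] by blast
  \<comment> \<open>\<open>X\<close> encodes an orientation of \<open>D\<close>: its members point
    from the smaller to the larger endpoint, the other edges of \<open>D\<close> the opposite way.
    The source is the vertex that picks.\<close>
  define src where "src X e = (if e \<in> X then Min e else Max e)" for X and e :: "nat set"
  define tgt where "tgt X e = (if e \<in> X then Max e else Min e)" for X and e :: "nat set"
  define B where "B X = {f :: nat \<times> nat \<Rightarrow> nat. \<forall>e\<in>D. tgt X e div m \<le> t \<and>
      f (src X e, tgt X e div m) = tgt X e mod m}" for X
  have e: "src X e < N" "e = {src X e, tgt X e}" if "e \<in> D" for X e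
    using all_edgesE[of e "{..<N}"] D that by (auto simp: src_def tgt_def)
  have single: "?P (B X) \<le> (1 / real m) ^ card D" for X
  proof (cases "(\<forall>e\<in>D. tgt X e div m \<le> t) \<and> inj_on (\<lambda>e. (src X e, tgt X e div m)) D")
    case True
    then have "B X = {f. \<forall>e\<in>D. f (src X e, tgt X e div m) = tgt X e mod m}"
      by (auto simp: B_def)
    then show ?thesis
      using prob_pick_pmf_values_le[OF m, of "\<lambda>e. (src X e, tgt X e div m)" D N t] True e(1)
      by force
  next
    case False
    have "f \<notin> B X" for f
    proof
      assume f: "f \<in> B X"
      with False obtain d d' where d: "d \<in> D" "d' \<in> D" "d \<noteq> d'" "src X d = src X d'"
          "tgt X d div m = tgt X d' div m"
        by (auto simp: B_def inj_on_def)
      then have "tgt X d mod m = tgt X d' mod m"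
        using f unfolding B_def by (metis (mono_tags, lifting) mem_Collect_eq)
      \<comment> \<open>Block and offset determine the target, so two arcs that read the same pick
        coincide.\<close>
      then have "tgt X d = tgt X d'" using d(5) by (metis div_mod_decomp)
      then show False using e(2)[OF d(1), of X] e(2)[OF d(2), of X] d(3,4) by simp
    qed
    then have "B X = {}" by auto
    then show ?thesis by simp
  qed
  have "{f. D \<subseteq> pick_graph N t m f} \<subseteq> (\<Union>X\<in>Pow D. B X)"
  proof
    fix f assume "f \<in> {f. D \<subseteq> pick_graph N t m f}"
    then have f: "D \<subseteq> pick_graph N t m f" by simp
    \<comment> \<open>The edges picked by their smaller endpoint. Every other edge of
      \<open>D\<close> must have been picked by its larger one.\<close>
    define X where "X = {e \<in> D. Max e div m \<le> t \<and> f (Min e, Max e div m) = Max e mod m}"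
    have "tgt X e div m \<le> t \<and> f (src X e, tgt X e div m) = tgt X e mod m"
      if e: "e \<in> D" for e
    proof -
      obtain u v where uv: "e = {u, v}" "u \<noteq> v" "v div m \<le> t" "f (u, v div m) = v mod m"
        using f e unfolding pick_graph_def by blast
      show ?thesis
      proof (cases "u < v")
        case True
        then have "Min e = u" "Max e = v" using uv(1) by auto
        then show ?thesis using uv e by (auto simp: src_def tgt_def X_def)
      next
        case False
        then have "Min e = v" "Max e = u" using uv(1) by auto
        then show ?thesis using uv e by (auto simp: src_def tgt_def X_def)
      qed
    qed
    then have "f \<in> B X" by (simp add: B_def)
    moreover have "X \<in> Pow D" by (auto simp: X_def)
    ultimately show "f \<in> (\<Union>X\<in>Pow D. B X)" by blast
  qed
  then have "?P {f. D \<subseteq> pick_graph N t m f} \<le> ?P (\<Union>X\<in>Pow D. B X)"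
    by (intro measure_pmf.finite_measure_mono) auto
  also have "\<dots> \<le> (\<Sum>X\<in>Pow D. ?P (B X))"
    by (rule measure_pmf.finite_measure_subadditive_finite) (use finD in auto)
  \<comment> \<open>Union bound: the \<open>2 ^ card D\<close> orientations turn
    \<open>1 / m\<close> into \<open>2 / m\<close>.\<close>
  also have "\<dots> \<le> (\<Sum>X\<in>Pow D. (1 / real m) ^ card D)" by (intro sum_mono single)
  also have "\<dots> = (2 / real m) ^ card D"
    using finD by (simp add: card_Pow power_divide)
  finally show ?thesis .
qed

text \<open>In this bound the pick graph acts like a binomial random graph of density
  \<open>2 / m\<close>. The integrand is the term \<open>D = K \<inter> H\<close> of a sum over all
  \<open>D \<subseteq> K\<close> contained in the pick graph \<open>H\<close>; taking expectations
  gives the expansion of \<open>(2 / m + p) ^ card K\<close>.\<close>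

lemma expectation_power_card_diff_pick_graph_le:
  assumes m: "0 < m" and p: "0 \<le> p" and K: "K \<subseteq> all_edges {..<N}"
  shows "measure_pmf.expectation (pick_pmf N t m) (\<lambda>f. p ^ card (K - pick_graph N t m f))
    \<le> (2 / real m + p) ^ card K"
proof -
  let ?M = "pick_pmf N t m" and ?H = "pick_graph N t m"
  have finK: "finite K" using K finite_subset[OF _ finite_all_edges] by blast
  have intg: "integrable (measure_pmf ?M) h" for h :: "_ \<Rightarrow> real"
    by (rule integrable_measure_pmf_finite[OF finite_set_pick_pmf[OF m]])
  have "measure_pmf.expectation ?M (\<lambda>f. p ^ card (K - ?H f)) \<le>
      measure_pmf.expectation ?M
        (\<lambda>f. \<Sum>D\<in>Pow K. indicator {f. D \<subseteq> ?H f} f * p ^ card (K - D))"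
  proof (rule integral_mono[OF intg intg])
    fix f
    have "p ^ card (K - ?H f) =
        indicator {g. K \<inter> ?H f \<subseteq> ?H g} f * p ^ card (K - K \<inter> ?H f)"
      by (simp add: Diff_Int)
    also have "\<dots> \<le> (\<Sum>D\<in>Pow K. indicator {f. D \<subseteq> ?H f} f * p ^ card (K - D))"
      using finK p
      by (intro member_le_sum[of "K \<inter> ?H f" "Pow K"
            "\<lambda>D. indicator {g. D \<subseteq> ?H g} f * p ^ card (K - D)"]) auto
    finally show "p ^ card (K - ?H f) \<le>
        (\<Sum>D\<in>Pow K. indicator {f. D \<subseteq> ?H f} f * p ^ card (K - D))" .
  qed
  also have "\<dots> = (\<Sum>D\<in>Pow K. measure_pmf.prob ?M {f. D \<subseteq> ?H f} * p ^ card (K - D))"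
    by (subst Bochner_Integration.integral_sum) (auto intro: intg)
  also have "\<dots> \<le> (\<Sum>D\<in>Pow K. (2 / real m) ^ card D * p ^ card (K - D))"
    using K p by (intro sum_mono mult_right_mono prob_pick_graph_superset_le[OF m]) auto
  also have "\<dots> = (\<Prod>x\<in>K. 2 / real m + p)"
    by (subst prod_add[OF finK]) simp
  also have "\<dots> = (2 / real m + p) ^ card K" by simp
  finally show ?thesis .
qed

text \<open>The degree bound holds for every outcome in the support, so only the sum needs control,
  and some outcome does not exceed its mean. Each summand bounds the probability that the random
  graph supplies the edges of \<open>S\<close> missing from \<open>H\<close>.\<close>

lemma exists_graph_min_degree_few_cliques:
  assumes m: "0 < m" and N: "Suc t * m \<le> N" and p: "0 \<le> p"
  obtains H where "H \<subseteq> all_edges {..<N}" "\<And>v. v < N \<Longrightarrow> t \<le> degree H v"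
    "(\<Sum>S | S \<subseteq> {..<N} \<and> card S = j. p ^ card (all_edges S - H))
      \<le> real (N choose j) * (2 / real m + p) ^ (j choose 2)"
proof -
  let ?M = "pick_pmf N t m" and ?H = "pick_graph N t m"
  let ?\<S> = "{S. S \<subseteq> {..<N} \<and> card S = j}"
  define b where "b = real (N choose j) * (2 / real m + p) ^ (j choose 2)"
  define W where "W f = (\<Sum>S\<in>?\<S>. p ^ card (all_edges S - ?H f))" for f
  have intg: "integrable (measure_pmf ?M) h" for h :: "_ \<Rightarrow> real"
    by (rule integrable_measure_pmf_finite[OF finite_set_pick_pmf[OF m]])
  have "measure_pmf.expectation ?M W =
      (\<Sum>S\<in>?\<S>. measure_pmf.expectation ?M (\<lambda>f. p ^ card (all_edges S - ?H f)))"
    unfolding W_def by (rule Bochner_Integration.integral_sum) (rule intg)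
  also have "\<dots> \<le> (\<Sum>S\<in>?\<S>. (2 / real m + p) ^ (j choose 2))"
  proof (rule sum_mono)
    fix S assume S: "S \<in> ?\<S>"
    then have "all_edges S \<subseteq> all_edges {..<N}" by (auto simp: all_edges_def)
    moreover have "card (all_edges S) = j choose 2"
      using S by (auto simp: card_all_edges finite_subset[of S "{..<N}"])
    ultimately show "measure_pmf.expectation ?M (\<lambda>f. p ^ card (all_edges S - ?H f))
        \<le> (2 / real m + p) ^ (j choose 2)"
      using expectation_power_card_diff_pick_graph_le[OF m p, of "all_edges S" N t] by simp
  qed
  also have "\<dots> = b" by (simp add: b_def n_subsets)
  finally have le: "measure_pmf.expectation ?M W \<le> b" .
  have "\<exists>f\<in>set_pmf ?M. W f \<le> b"
  proof (rule ccontr)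
    assume "\<not> (\<exists>f\<in>set_pmf ?M. W f \<le> b)"
    then have "AE f in measure_pmf ?M. b < W f" by (auto simp: AE_measure_pmf_iff)
    from measure_pmf.expectation_greater[OF intg this] le show False by simp
  qed
  then obtain f where f: "f \<in> set_pmf ?M" "W f \<le> b" by blast
  show thesis
  proof (rule that)
    show "?H f \<subseteq> all_edges {..<N}" by (rule pick_graph_subset)
    show "t \<le> degree (?H f) v" if "v < N" for v
      by (rule degree_pick_graph[OF _ N that]) (rule set_pmf_pick_pmf[OF f(1) m that])
    show "(\<Sum>S\<in>?\<S>. p ^ card (all_edges S - ?H f))
      \<le> real (N choose j) * (2 / real m + p) ^ (j choose 2)"
      using f(2) unfolding W_def b_def .
  qed
qed

text \<open>Markov's inequality. Inside \<open>A\<close> all edges of \<open>E\<close> lie in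
  \<open>H\<close>, so the random graph must supply \<open>all_edges S - H\<close>.\<close>

lemma prob_many_cliques_le:
  assumes V: "finite V" and A: "A \<subseteq> V" and H: "E \<inter> all_edges A \<subseteq> H" and p: "0 \<le> p" and a: "0 < a"
  shows "measure_pmf.prob (binomial_random_graph V p) {R. a \<le> real (card (cliques A (E \<union> R) j))}
    \<le> (\<Sum>S | S \<subseteq> A \<and> card S = j. p ^ card (all_edges S - H)) / a"
proof -
  let ?\<S> = "{S. S \<subseteq> A \<and> card S = j}"
  have fin: "finite ?\<S>" using finite_subset[OF A V] by simp
  have "cliques A (E \<union> R) j = {S \<in> ?\<S>. all_edges S \<subseteq> E \<union> R}" for R
    by (auto simp: cliques_def clique_copy_def)
  then have "measure_pmf.prob (binomial_random_graph V p) {R. a \<le> real (card (cliques A (E \<union> R) j))}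
    \<le> (\<Sum>S\<in>?\<S>. measure_pmf.prob (binomial_random_graph V p) {R. all_edges S \<subseteq> E \<union> R}) / a"
    using prob_card_ge_le[OF fin a] by simp
  also have "\<dots> \<le> (\<Sum>S\<in>?\<S>. p ^ card (all_edges S - H)) / a"
  proof (intro divide_right_mono sum_mono)
    fix S assume S: "S \<in> ?\<S>"
    then have SV: "all_edges S \<subseteq> all_edges A" "all_edges S \<subseteq> all_edges V"
      using A by (auto simp: all_edges_def)
    have "measure_pmf.prob (binomial_random_graph V p) {R. all_edges S \<subseteq> E \<union> R} \<le>
       measure_pmf.prob (binomial_random_graph V p) {R. all_edges S - H \<subseteq> R}"
      using SV(1) H by (intro measure_pmf.finite_measure_mono) auto
    also have "\<dots> \<le> p ^ card (all_edges S - H)"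
      using SV(2) by (intro prob_binomial_random_graph_superset_le[OF V p]) auto
    finally show "measure_pmf.prob (binomial_random_graph V p) {R. all_edges S \<subseteq> E \<union> R}
      \<le> p ^ card (all_edges S - H)" .
  qed (use a in simp)
  finally show ?thesis .
qed

subsection \<open>Isolated vertices\<close>

text \<open>Chebyshev's inequality: the mean is \<mu> and the variance at most
  \<open>\<mu> + 2 * p * \<mu>\<^sup>2\<close>, which is divided by
  \<open>(\<mu> / 2)\<^sup>2\<close>.\<close>

lemma prob_few_isolated_le:
  assumes V: "finite V" and A: "A \<subseteq> V" and E: "E \<inter> all_edges A = {}"
    and p: "0 \<le> p" "p \<le> 1/2" and A2: "2 \<le> card A"
  defines "\<mu> \<equiv> real (card A) * (1 - p) ^ (card A - 1)"
  shows "measure_pmf.prob (binomial_random_graph V p)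
      {R. real (card (isolated A (E \<union> R))) \<le> \<mu> / 2} \<le> 4 / \<mu> + 8 * p"
proof -
  let ?M = "binomial_random_graph V p"
  define X where "X R = real (card (isolated A (E \<union> R)))" for R
  define N where "N = card A"
  define q where "q = (1 - p) ^ (N - 1)"
  have finA: "finite A" by (rule finite_subset[OF A V])
  have q0: "0 < q" using p by (simp add: q_def)
  have \<mu>: "\<mu> = real N * q" by (simp add: \<mu>_def N_def q_def)
  have \<mu>0: "0 < \<mu>" using q0 A2 by (simp add: \<mu> N_def)
  define star where "star v = {e \<in> all_edges A. v \<in> e}" for v
  have star: "star v \<subseteq> all_edges V" "finite (star v)" for v
    using A finite_subset[OF _ finite_all_edges[OF finA], of "star v"]
    by (auto simp: star_def all_edges_def)
  have iso: "isolated A (E \<union> R) = {v \<in> A. \<forall>e\<in>star v. e \<notin> R}" for R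
    using E by (auto simp: isolated_def star_def)
  have card_star: "card (star v) = N - 1" if "v \<in> A" for v
    using card_incident_edges[OF finA that] by (simp add: star_def N_def)
  have pr: "measure_pmf.prob ?M {R. \<forall>e\<in>D. e \<notin> R} = (1 - p) ^ card D"
    if "D \<subseteq> all_edges V" for D
    by (rule prob_binomial_random_graph_disjoint[OF V p(1) _ that]) (use p(2) in simp)
  have "X = (\<lambda>R. real (card {v \<in> A. \<forall>e\<in>star v. e \<notin> R}))" by (simp add: X_def iso fun_eq_iff)
  then have EX: "measure_pmf.expectation ?M X = \<mu>"
    by (simp add: expectation_card[OF finA] pr[OF star(1)] card_star \<mu> q_def N_def)
  have "(X R)\<^sup>2 = real (card {x \<in> A \<times> A. \<forall>e\<in>star (fst x) \<union> star (snd x). e \<notin> R})" for R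
  proof -
    have "{x \<in> A \<times> A. \<forall>e\<in>star (fst x) \<union> star (snd x). e \<notin> R} =
        isolated A (E \<union> R) \<times> isolated A (E \<union> R)"
      by (auto simp: iso)
    then show ?thesis by (simp add: X_def card_cartesian_product power2_eq_square)
  qed
  then have "measure_pmf.expectation ?M (\<lambda>R. (X R)\<^sup>2) =
      (\<Sum>x\<in>A \<times> A. (1 - p) ^ card (star (fst x) \<union> star (snd x)))"
    using finA star by (simp add: expectation_card pr)
  \<comment> \<open>The diagonal terms \<open>q\<close> add up to \<mu>. The stars of distinct
    vertices share exactly the edge between them, so such a pair has probability
    \<open>q\<^sup>2 / (1 - p)\<close>.\<close>
  also have "\<dots> \<le> (\<Sum>x\<in>A \<times> A. (if fst x = snd x then q else 0) + (1 + 2 * p) * q\<^sup>2)"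
  proof (rule sum_mono)
    fix x assume "x \<in> A \<times> A"
    then obtain u v where x: "x = (u, v)" "u \<in> A" "v \<in> A" by auto
    show "(1 - p) ^ card (star (fst x) \<union> star (snd x))
        \<le> (if fst x = snd x then q else 0) + (1 + 2 * p) * q\<^sup>2"
    proof (cases "u = v")
      case True
      then show ?thesis using x card_star p by (simp add: q_def)
    next
      case False
      have "e = {u, v}" if "e \<in> star u \<inter> star v" for e
        using that False card_seteq[of e "{u, v}"] card.infinite[of e]
        by (auto simp: star_def all_edges_def)
      moreover have "{u, v} \<in> star u \<inter> star v"
        using False x by (simp add: star_def all_edges_def)
      ultimately have "star u \<inter> star v = {{u, v}}" by blast
      then have union: "Suc (card (star u \<union> star v)) = (N - 1) + (N - 1)"
        using card_Un_Int[OF star(2)[of u] star(2)[of v]] card_star x by simp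
      have q2: "(1 - p) ^ card (star u \<union> star v) * (1 - p) = q\<^sup>2"
        unfolding power_Suc2[symmetric] union by (simp add: q_def power_add power2_eq_square)
      \<comment> \<open>The difference of the two sides is \<open>p * (1 - 2 * p)\<close>,
        nonnegative for \<open>p \<le> 1/2\<close>.\<close>
      have "1 \<le> (1 - p) * (1 + 2 * p)"
        using mult_nonneg_nonneg[of p "1 - 2 * p"] p by (simp add: algebra_simps)
      then have "(1 - p) ^ card (star u \<union> star v) * 1 \<le>
          (1 - p) ^ card (star u \<union> star v) * ((1 - p) * (1 + 2 * p))"
        using p by (intro mult_left_mono) auto
      also have "\<dots> = (1 + 2 * p) * q\<^sup>2"
        unfolding q2[symmetric] by (simp only: mult_ac)
      finally show ?thesis using False x by simp
    qed
  qed
  also have "\<dots> = (\<Sum>u\<in>A. \<Sum>v\<in>A. if u = v then q else 0) + (\<Sum>x\<in>A \<times> A. (1 + 2 * p) * q\<^sup>2)"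
    unfolding sum.distrib by (simp add: sum.cartesian_product case_prod_beta)
  also have "\<dots> = \<mu> + (1 + 2 * p) * \<mu>\<^sup>2"
    using finA by (simp add: \<mu> N_def power2_eq_square algebra_simps)
  finally have EX2: "measure_pmf.expectation ?M (\<lambda>R. (X R)\<^sup>2) \<le> \<mu> + (1 + 2 * p) * \<mu>\<^sup>2" .
  have Xb: "0 \<le> X R" "X R \<le> real N" for R
    unfolding X_def iso N_def using card_mono[OF finA, of "{v \<in> A. \<forall>e\<in>star v. e \<notin> R}"] by auto
  have int: "integrable (measure_pmf ?M) X"
    by (rule measure_pmf.integrable_const_bound[where B = "real N"]) (use Xb in auto)
  have int2: "integrable (measure_pmf ?M) (\<lambda>R. (X R)\<^sup>2)"
    by (rule measure_pmf.integrable_const_bound[where B = "(real N)\<^sup>2"])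
       (use Xb in \<open>auto intro!: power_mono\<close>)
  have "measure_pmf.variance ?M X = measure_pmf.expectation ?M (\<lambda>R. (X R)\<^sup>2) - \<mu>\<^sup>2"
    by (subst measure_pmf.variance_eq[OF int int2]) (simp add: EX)
  then have var: "measure_pmf.variance ?M X \<le> \<mu> + 2 * p * \<mu>\<^sup>2"
    using EX2 by (simp add: algebra_simps)
  have "measure_pmf.prob ?M {R. X R \<le> \<mu> / 2} \<le> measure_pmf.prob ?M {R. \<mu> / 2 \<le> \<bar>X R - \<mu>\<bar>}"
    by (rule measure_pmf.finite_measure_mono) (use \<mu>0 in auto)
  also have "\<dots> \<le> measure_pmf.variance ?M X / (\<mu> / 2)\<^sup>2"
    using measure_pmf.Chebyshev_inequality[of X ?M "\<mu> / 2"] int2 \<mu>0 by (simp add: EX)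
  also have "\<dots> \<le> (\<mu> + 2 * p * \<mu>\<^sup>2) / (\<mu> / 2)\<^sup>2"
    by (rule divide_right_mono[OF var]) simp
  also have "\<dots> = 4 / \<mu> + 8 * p"
    using \<mu>0 by (simp add: field_simps power2_eq_square)
  finally show ?thesis by (simp add: X_def)
qed

subsection \<open>The extremal graph\<close>

definition perturbation_base :: "nat \<Rightarrow> nat \<Rightarrow> nat set set \<Rightarrow> nat set set" where
  "perturbation_base n N H = {e \<in> all_edges {..<n}. \<not> e \<subseteq> {..<N}} \<union> H"

lemma simple_graph_perturbation_base:
  assumes "H \<subseteq> all_edges {..<N}" "N \<le> n"
  shows "simple_graph {..<n} (perturbation_base n N H)"
proof -
  have "all_edges {..<N} \<subseteq> all_edges {..<n}"
    using assms(2) by (intro all_edges_mono) simp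
  then have "perturbation_base n N H \<subseteq> all_edges {..<n}"
    using assms(1) unfolding perturbation_base_def by blast
  then show ?thesis by (simp add: simple_graph_def)
qed

text \<open>A vertex below \<open>N\<close> has \<open>n - N\<close> neighbours outside and at least
  \<open>t\<close> in \<open>H\<close>; the others are adjacent to all \<open>n - 1\<close>
  remaining vertices.\<close>

lemma min_degree_perturbation_base:
  assumes H: "H \<subseteq> all_edges {..<N}" and deg: "\<And>v. v < N \<Longrightarrow> t \<le> degree H v"
    and N: "N \<le> n" and n: "0 < n" and d: "d \<le> n - 1" "N + d \<le> n + t"
  shows "d \<le> min_degree {..<n} (perturbation_base n N H)"
proof -
  let ?E = "perturbation_base n N H"
  have finE: "finite ?E" "finite H"
    using finite_subset[OF _ finite_all_edges[of "{..<n}"], of ?E]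
      finite_subset[OF H finite_all_edges] simple_graph_perturbation_base[OF H N]
    by (simp_all add: simple_graph_def)
  have "d \<le> degree ?E v" if v: "v < n" for v
  proof (cases "v < N")
    case True
    have inj: "inj_on (\<lambda>u. {v, u}) {N..<n}" by (auto simp: inj_on_def doubleton_eq_iff)
    have "d \<le> (n - N) + t" using d(2) N by linarith
    also have "\<dots> \<le> card ((\<lambda>u. {v, u}) ` {N..<n}) + card {e \<in> H. v \<in> e}"
      using deg[OF True] by (simp add: card_image[OF inj] degree_def)
    also have "\<dots> = card ((\<lambda>u. {v, u}) ` {N..<n} \<union> {e \<in> H. v \<in> e})"
    proof (rule card_Un_disjoint[symmetric])
      have "u < N" if "{v, u} \<in> H" for u
        using that H by (auto simp: all_edges_def)
      then have "{v, u} \<notin> H" if "u \<in> {N..<n}" for u using that by fastforce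
      then show "(\<lambda>u. {v, u}) ` {N..<n} \<inter> {e \<in> H. v \<in> e} = {}" by blast
    qed (use finE in simp_all)
    also have "\<dots> \<le> degree ?E v"
      unfolding degree_def
    proof (rule card_mono)
      have "{v, u} \<in> ?E" if u: "u \<in> {N..<n}" for u
      proof -
        have "v \<noteq> u" using u True by simp
        then show ?thesis using u True v by (simp add: perturbation_base_def all_edges_def)
      qed
      moreover have "H \<subseteq> ?E" by (simp add: perturbation_base_def)
      ultimately show "(\<lambda>u. {v, u}) ` {N..<n} \<union> {e \<in> H. v \<in> e} \<subseteq> {e \<in> ?E. v \<in> e}"
        by blast
    qed (use finE in simp)
    finally show ?thesis .
  next
    case False
    have "d \<le> card {e \<in> all_edges {..<n}. v \<in> e}"
      using card_incident_edges[of "{..<n}" v] v d(1) by simp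
    also have "\<dots> \<le> degree ?E v"
      unfolding degree_def
    proof (rule card_mono)
      show "{e \<in> all_edges {..<n}. v \<in> e} \<subseteq> {e \<in> ?E. v \<in> e}"
        using False by (auto simp: perturbation_base_def)
    qed (use finE in simp)
    finally show ?thesis .
  qed
  then show ?thesis using n unfolding min_degree_def by (subst Min_ge_iff) auto
qed

lemma perturbation_base_Int:
  "perturbation_base n N H \<inter> all_edges {..<N} \<subseteq> H"
  by (auto simp: perturbation_base_def all_edges_def)

lemma clique_factor_perturbation_subset:
  assumes "n = r * k" "N = s * k + t" "N \<le> n" "2 \<le> s" "0 < r"
  shows "{R. has_clique_factor {..<n} (E \<union> R) r} \<subseteq>
    {R. t + card (isolated {..<N} (E \<union> R)) \<le> card (cliques {..<N} (E \<union> R) (Suc s))}"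
  using clique_factor_excess[of "{..<n}" "{..<N}" _ r k s t] assms by auto

lemma exists_graphI:
  assumes "simple_graph {..<n} E" "n = r * k" "s < r" "(r - s) * k \<le> min_degree {..<n} E"
    and "measure_pmf.prob (binomial_random_graph {..<n} p) {R. has_clique_factor {..<n} (E \<union> R) r} < \<epsilon>"
  shows "\<exists>(V :: nat set) E. simple_graph V E \<and> card V = n \<and>
       real (min_degree V E) \<ge> (1 - real s / real r) * real n \<and>
       measure_pmf.prob (binomial_random_graph V p) {R. has_clique_factor V (E \<union> R) r} < \<epsilon>"
proof -
  have "(1 - real s / real r) * real n = real ((r - s) * k)"
    using assms(2,3) by (simp add: of_nat_diff field_simps)
  then have "(1 - real s / real r) * real n \<le> real (min_degree {..<n} E)"
    using assms(4) by linarith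
  then show ?thesis using assms(1,5) by (intro exI[of _ "{..<n}"] exI[of _ E]) simp
qed

section \<open>Choice of parameters for s \<ge> 3 and for s = 2\<close>

lemma binomial_le_power: "N choose j \<le> N ^ j"
  by (cases "j \<le> N") (auto intro: binomial_le_pow simp: binomial_eq_0)

text \<open>All asymptotics are deferred to explicit inequalities in \<open>n\<close> and
  \<open>p\<close>. The left side of \<open>small\<close> is Markov's bound
  \<open>n ^ Suc s * (13 * r * p) ^ K / t\<close> with \<open>t\<close> replaced by
  \<open>n * p\<close>, where \<open>K = Suc s choose 2\<close>.\<close>

lemma exists_graph_without_clique_factor:
  fixes r s n :: nat and p \<epsilon> :: real
  assumes s: "3 \<le> s" "s < r" and rn: "r dvd n" and np: "1 \<le> real n * p" and p: "3 * real r * p \<le> 1" "0 < p"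
    and small: "real n ^ s * (13 * real r) ^ (Suc s choose 2) * p ^ ((Suc s choose 2) - 1) < \<epsilon>"
  shows "\<exists>(V :: nat set) E. simple_graph V E \<and> card V = n \<and>
       real (min_degree V E) \<ge> (1 - real s / real r) * real n \<and>
       measure_pmf.prob (binomial_random_graph V p) {R. has_clique_factor V (E \<union> R) r} < \<epsilon>"
proof -
  let ?K = "Suc s choose 2"
  obtain k where n: "n = r * k" using rn by blast
  have n0: "0 < n" using np p by (cases n) auto
  have k0: "0 < k" using n n0 by simp
  define t where "t = nat \<lceil>real n * p\<rceil>"
  define N where "N = s * k + t"
  define m where "m = N div Suc t"
  have t: "real n * p \<le> real t" "real t \<le> 2 * (real n * p)" "1 \<le> t"
    using np by (auto simp: t_def) linarith+
  have "real n * (3 * real r * p) \<le> real n * 1" using p by (intro mult_left_mono) auto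
  \<comment> \<open>This gives \<open>Suc t \<le> k\<close>, so that
    \<open>N \<le> Suc s * k \<le> n\<close> and the blocks are nonempty.\<close>
  then have "3 * (real n * p) * real r \<le> real k * real r" using n by (simp add: mult_ac)
  then have nk: "3 * (real n * p) \<le> real k" using s by simp
  have "real (Suc t) \<le> real k" using t(2) nk np by simp
  then have tk: "Suc t \<le> k" by simp
  have "k \<le> s * k" using s by simp
  then have kN: "k \<le> N" unfolding N_def by linarith
  have "N \<le> Suc s * k" using tk by (simp add: N_def)
  also have "\<dots> \<le> n" unfolding n using s by (intro mult_le_mono1) simp
  finally have Nn: "N \<le> n" .
  have m0: "0 < m" unfolding m_def using tk kN by (simp add: div_greater_zero_iff)
  have "Suc t * m \<le> N" unfolding m_def by (rule times_div_less_eq_dividend)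
  from exists_graph_min_degree_few_cliques[OF m0 this, of p "Suc s"] p(2)
  obtain H where H: "H \<subseteq> all_edges {..<N}" "\<And>v. v < N \<Longrightarrow> t \<le> degree H v"
    "(\<Sum>S | S \<subseteq> {..<N} \<and> card S = Suc s. p ^ card (all_edges S - H))
      \<le> real (N choose Suc s) * (2 / real m + p) ^ ?K" by auto
  let ?E = "perturbation_base n N H"
  have simple: "simple_graph {..<n} ?E" by (rule simple_graph_perturbation_base[OF H(1) Nn])
  have "(r - s) * k + s * k = n" using n s add_mult_distrib[of "r - s" s k] by simp
  moreover have "1 \<le> s * k" using k0 s by simp
  ultimately have "(r - s) * k \<le> n - 1" "N + (r - s) * k \<le> n + t"
    unfolding N_def by linarith+
  then have deg: "(r - s) * k \<le> min_degree {..<n} ?E"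
    by (intro min_degree_perturbation_base[OF H(1,2) Nn n0])
  \<comment> \<open>Origin of the constant 13: rounding in \<open>m\<close> costs at most a factor
    2, and \<open>t + 1 \<le> 3 * n * p\<close>, hence \<open>k < 6 * n * p * m\<close>. With
    \<open>n = r * k\<close> this yields \<open>2 / m \<le> 12 * r * p\<close>, and the random graph
    adds \<open>p \<le> r * p\<close>.\<close>
  have "k < 2 * (Suc t * m)"
  proof -
    have "k < Suc t * m + Suc t"
      using kN mult_div_mod_eq[of "Suc t" N] mod_less_divisor[of "Suc t" N]
      unfolding m_def by linarith
    moreover have "Suc t * 1 \<le> Suc t * m" using m0 by (intro mult_le_mono2) simp
    ultimately show ?thesis unfolding mult_2 by (metis add_left_mono less_le_trans mult_1_right)
  qed
  then have "real k < 2 * (real (Suc t) * real m)"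
    by (metis of_nat_less_iff of_nat_mult of_nat_numeral)
  also have "\<dots> \<le> 2 * ((3 * (real n * p)) * real m)"
    using t(2) np by (intro mult_left_mono mult_right_mono) auto
  also have "\<dots> = real k * (6 * real r * p * real m)" using n by simp
  finally have "1 < 6 * real r * p * real m" using k0 by simp
  then have "2 / real m \<le> 12 * real r * p" using m0 by (simp add: field_simps)
  moreover have "p \<le> real r * p" using p s by simp
  ultimately have w: "2 / real m + p \<le> 13 * real r * p" by linarith
  have K: "?K = Suc (?K - 1)" using s by (simp add: choose_two)
  have "measure_pmf.prob (binomial_random_graph {..<n} p) {R. has_clique_factor {..<n} (?E \<union> R) r}
    \<le> measure_pmf.prob (binomial_random_graph {..<n} p)
        {R. real t \<le> real (card (cliques {..<N} (?E \<union> R) (Suc s)))}"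
    using clique_factor_perturbation_subset[OF n N_def Nn, of ?E] s
    by (intro measure_pmf.finite_measure_mono) fastforce+
  also have "\<dots> \<le> (\<Sum>S | S \<subseteq> {..<N} \<and> card S = Suc s. p ^ card (all_edges S - H)) / real t"
    by (rule prob_many_cliques_le) (use Nn p t(3) perturbation_base_Int in auto)
  also have "\<dots> \<le> (real n ^ Suc s * (13 * real r * p) ^ ?K) / real t"
  proof (rule divide_right_mono)
    have "N choose Suc s \<le> n ^ Suc s"
      using binomial_le_power[of N "Suc s"] power_mono[OF Nn, of "Suc s"] by linarith
    then have "real (N choose Suc s) \<le> real n ^ Suc s"
      by (metis of_nat_le_iff of_nat_power)
    then have "real (N choose Suc s) * (2 / real m + p) ^ ?K
        \<le> real n ^ Suc s * (13 * real r * p) ^ ?K"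
      using w p by (intro mult_mono power_mono) auto
    with H(3) show "(\<Sum>S | S \<subseteq> {..<N} \<and> card S = Suc s. p ^ card (all_edges S - H))
        \<le> real n ^ Suc s * (13 * real r * p) ^ ?K" by linarith
  qed simp
  also have "\<dots> \<le> (real n ^ Suc s * (13 * real r * p) ^ ?K) / (real n * p)"
    using t np p by (intro divide_left_mono) auto
  also have "\<dots> = real n ^ s * (13 * real r) ^ ?K * p ^ (?K - 1)"
  proof -
    have "(13 * real r * p) ^ ?K = (13 * real r) ^ ?K * (p * p ^ (?K - 1))"
      unfolding power_mult_distrib by (metis K power_Suc)
    then show ?thesis using n0 p by simp
  qed
  also have "\<dots> < \<epsilon>" by (rule small)
  finally show ?thesis by (intro exists_graphI[OF simple n s(2) deg])
qed

lemma theorem1p3_ge_3: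
  fixes r s :: nat and \<epsilon> :: real
  assumes s: "3 \<le> s" and sr: "s < r" and \<epsilon>: "\<epsilon> > 0"
  shows "\<exists>c>0. \<exists>N. \<forall>n\<ge>N. r dvd n \<longrightarrow>
    (\<exists>(V :: nat set) E. simple_graph V E \<and> card V = n \<and>
       real (min_degree V E) \<ge> (1 - real s / real r) * real n \<and>
       measure_pmf.prob (binomial_random_graph V (c * p_fun s n))
         {R. has_clique_factor V (E \<union> R) r} < \<epsilon>)"
proof -
  define K where "K = (Suc s choose 2)"
  define a where "a = varphi s"
  \<comment> \<open>Chosen so that the final bound \<open>(13 * r) ^ K * c\<close> is at most
    \<open>\<epsilon> / 2\<close>; \<open>c \<le> 1\<close> allows replacing
    \<open>c ^ (K - 1)\<close> by \<open>c\<close>.\<close>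
  define c where "c = min 1 (\<epsilon> / (2 * (13 * real r) ^ K))"
  have r0: "0 < real r" using sr by simp
  have c: "0 < c" "c \<le> 1" using \<epsilon> r0 by (auto simp: c_def)
  have den: "0 < (real s - 1) * (real s + 2)" using s by simp
  \<comment> \<open>The product equals \<open>(s - 1) * (s + 2) - 2 * s\<close>, so this says
    \<open>a < 1\<close>, which makes \<open>n * p\<close> tend to infinity.\<close>
  have "(real s - 2) * (real s + 1) > 0" using s by simp
  then have a: "0 < a" "a < 1"
    using den s unfolding a_def varphi_def by (auto simp: divide_less_eq algebra_simps)
  have "2 * K = Suc s * s" unfolding K_def choose_two by simp
  then have "2 * real K = real (Suc s) * real s"
    by (metis of_nat_mult of_nat_numeral)
  moreover have K1: "2 \<le> K" using \<open>2 * K = Suc s * s\<close> s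
    using mult_le_mono[of 4 "Suc s" 3 s] by linarith
  ultimately have K2: "real (K - 1) = (real s - 1) * (real s + 2) / 2"
    by (simp add: of_nat_diff algebra_simps)
  have "a * real (K - 1) = real s" using den unfolding a_def varphi_def K2 using s by simp
  \<comment> \<open>By this identity the powers of \<open>n\<close> in
    \<open>n ^ s * p ^ (K - 1)\<close> cancel, leaving \<open>c ^ (K - 1)\<close>.\<close>
  then have aK: "real (K - 1) * a = real s" by (simp add: mult.commute)
  have p: "c * p_fun s n = c * real n powr (- a)" for n using s by (simp add: p_fun_def a_def)
  have "eventually (\<lambda>n::nat. 1 \<le> real n * (c * real n powr (- a))) at_top"
    using a c by real_asymp
  moreover have "eventually (\<lambda>n::nat. 3 * real r * (c * real n powr (- a)) \<le> 1) at_top"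
    using a c r0 by real_asymp
  ultimately have "eventually (\<lambda>n::nat. 1 \<le> real n * (c * real n powr (- a)) \<and>
      3 * real r * (c * real n powr (- a)) \<le> 1) at_top"
    by (rule eventually_conj)
  then obtain N where N: "\<And>n. N \<le> n \<Longrightarrow> 1 \<le> real n * (c * real n powr (- a)) \<and>
      3 * real r * (c * real n powr (- a)) \<le> 1"
    unfolding eventually_sequentially by blast
  have small: "real n ^ s * (13 * real r) ^ K * (c * real n powr (- a)) ^ (K - 1) < \<epsilon>" if n: "0 < n" for n
  proof -
    have "(real n powr (- a)) ^ (K - 1) = real n powr (- real s)"
      using n aK by (simp add: powr_power)
    then have "real n ^ s * (real n powr (- a)) ^ (K - 1) = 1"
      using n by (simp add: powr_minus powr_realpow)
    then have "real n ^ s * (13 * real r) ^ K * (c * real n powr (- a)) ^ (K - 1)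
        = (13 * real r) ^ K * c ^ (K - 1)"
      unfolding power_mult_distrib by (simp add: mult_ac)
    also have "\<dots> \<le> (13 * real r) ^ K * c"
      using c K1 power_decreasing[of 1 "K - 1" c] by (intro mult_left_mono) auto
    also have "\<dots> \<le> (13 * real r) ^ K * (\<epsilon> / (2 * (13 * real r) ^ K))"
      by (intro mult_left_mono) (auto simp: c_def)
    also have "\<dots> < \<epsilon>" using r0 \<epsilon> by simp
    finally show ?thesis .
  qed
  show ?thesis
  proof (intro exI[of _ c] conjI exI[of _ N] allI impI)
    fix n assume n: "N \<le> n" "r dvd n"
    have n0: "0 < n" using N[OF n(1)] by (cases n) auto
    show "\<exists>(V :: nat set) E. simple_graph V E \<and> card V = n \<and>
       real (min_degree V E) \<ge> (1 - real s / real r) * real n \<and>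
       measure_pmf.prob (binomial_random_graph V (c * p_fun s n))
         {R. has_clique_factor V (E \<union> R) r} < \<epsilon>"
      unfolding p
      by (rule exists_graph_without_clique_factor[OF s sr n(2)])
         (use N[OF n(1)] c n0 small[OF n0] in \<open>auto simp: K_def\<close>)
  qed (fact c)
qed

lemma theorem1p3_2:
  fixes r :: nat and \<epsilon> :: real
  assumes r: "2 < r" and \<epsilon>: "\<epsilon> > 0"
  shows "\<exists>c>0. \<exists>N. \<forall>n\<ge>N. r dvd n \<longrightarrow>
    (\<exists>(V :: nat set) E. simple_graph V E \<and> card V = n \<and>
       real (min_degree V E) \<ge> (1 - real 2 / real r) * real n \<and>
       measure_pmf.prob (binomial_random_graph V (c * p_fun 2 n))
         {R. has_clique_factor V (E \<union> R) r} < \<epsilon>)"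
proof -
  \<comment> \<open>With \<open>N = 2 * n / r\<close> vertices in the sparse part,
    \<open>b n\<close> is \<open>N * n powr (-1/4)\<close>, a lower bound for the mean number \<mu>
    of isolated vertices. The factor 1/8 in \<open>p\<close> gives
    \<open>exp (- 2 * n * p) = n powr (-1/4)\<close>.\<close>
  define b where "b n = 2 / real r * real n powr (3/4)" for n :: nat
  define p where "p n = 1 / 8 * p_fun 2 n" for n
  have p_eq: "p n = ln (real n) / (8 * real n)" for n by (simp add: p_def p_fun_def)
  have r0: "0 < real r" using r by simp
  \<comment> \<open>The first two terms bound the probability of few isolated vertices, the third
    that of many triangles: a polylogarithm over a power of \<open>n\<close>.\<close>
  have "eventually (\<lambda>n. 4 / b n + 8 * p n + (real n * p n) ^ 3 / (b n / 2) < \<epsilon>) at_top"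
    using r0 \<epsilon> unfolding b_def p_eq by real_asymp
  moreover have "eventually (\<lambda>n. p n \<le> 1/2) at_top" unfolding p_eq by real_asymp
  ultimately have "eventually (\<lambda>n. 4 / b n + 8 * p n + (real n * p n) ^ 3 / (b n / 2) < \<epsilon> \<and> p n \<le> 1/2) at_top"
    by (rule eventually_conj)
  then obtain N0 where N0: "\<And>n. N0 \<le> n \<Longrightarrow> 4 / b n + 8 * p n + (real n * p n) ^ 3 / (b n / 2) < \<epsilon> \<and> p n \<le> 1/2"
    unfolding eventually_sequentially by blast
  show ?thesis
  \<comment> \<open>The maximum with 1 excludes \<open>n = 0\<close>, which \<open>r\<close>
    divides.\<close>
  proof (intro exI[of _ "1/8 :: real"] conjI exI[of _ "max 1 N0"] allI impI)
    fix n assume "max 1 N0 \<le> n" and rn: "r dvd n"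
    then have n0: "0 < n" and small: "4 / b n + 8 * p n + (real n * p n) ^ 3 / (b n / 2) < \<epsilon>" "p n \<le> 1/2"
      using N0 by auto
    obtain k where n: "n = r * k" using rn by blast
    have k0: "0 < k" using n n0 by simp
    define N where "N = 2 * k"
    have N: "N = 2 * k + 0" by (simp add: N_def)
    have Nn: "N \<le> n" unfolding N_def n using r by (intro mult_le_mono1) simp
    have p0: "0 \<le> p n" using n0 by (simp add: p_eq)
    have b0: "0 < b n" using n0 r by (simp add: b_def)
    define \<mu> where "\<mu> = real N * (1 - p n) ^ (N - 1)"
    have "real n powr (3/4) = real n * real n powr (-1/4)"
      using powr_add[of "real n" 1 "-1/4"] n0 by simp
    then have "b n = 2 / real r * real n * real n powr (-1/4)" by (simp add: b_def)
    also have "2 / real r * real n = real N" using r by (simp add: n N_def)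
    finally have "b n = real N * real n powr (-1/4)" .
    also have "\<dots> \<le> real N * (1 - p n) ^ (N - 1)"
    proof (rule mult_left_mono)
      have "- p n - 2 * (p n)\<^sup>2 \<le> ln (1 - p n)"
        using ln_one_minus_pos_lower_bound[OF p0 small(2)] .
      moreover have "2 * (p n)\<^sup>2 \<le> p n"
        using mult_left_mono[OF small(2) p0] by (simp add: power2_eq_square)
      ultimately have "real n * (- 2 * p n) \<le> real n * ln (1 - p n)"
        by (intro mult_left_mono) auto
      moreover have "real n * (- 2 * p n) = (-1/4) * ln (real n)" using n0 by (simp add: p_eq)
      ultimately have "real n powr (-1/4) \<le> exp (real n * ln (1 - p n))"
        using n0 by (simp add: powr_def)
      also have "\<dots> = (1 - p n) ^ n"
        using small(2) by (simp add: exp_of_nat_mult)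
      also have "\<dots> \<le> (1 - p n) ^ (N - 1)"
        using p0 small(2) Nn by (intro power_decreasing) auto
      finally show "real n powr (-1/4) \<le> (1 - p n) ^ (N - 1)" .
    qed simp
    finally have b\<mu>: "b n \<le> \<mu>" by (simp add: \<mu>_def)
    let ?E = "perturbation_base n N {}"
    let ?P = "measure_pmf.prob (binomial_random_graph {..<n} (p n))"
    have simple: "simple_graph {..<n} ?E" by (rule simple_graph_perturbation_base[OF _ Nn]) simp
    have "(r - 2) * k + 2 * k = n"
    proof -
      have "r - 2 + 2 = r" using r by simp
      then have "(r - 2 + 2) * k = n" by (simp only: n)
      then show ?thesis unfolding add_mult_distrib .
    qed
    then have deg: "(r - 2) * k \<le> min_degree {..<n} ?E"
      using k0 r by (intro min_degree_perturbation_base[OF _ _ Nn n0, of _ 0]) (auto simp: N_def)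
    have "?P {R. real (card (isolated {..<N} (?E \<union> R))) \<le> \<mu> / 2} \<le> 4 / \<mu> + 8 * p n"
      using prob_few_isolated_le[of "{..<n}" "{..<N}" ?E "p n"] perturbation_base_Int[of n N "{}"]
        Nn p0 small(2) k0 by (simp add: \<mu>_def N_def)
    also have "4 / \<mu> \<le> 4 / b n" using b0 b\<mu> by (intro divide_left_mono) auto
    finally have isol: "?P {R. real (card (isolated {..<N} (?E \<union> R))) \<le> \<mu> / 2} \<le> 4 / b n + 8 * p n"
      by simp
    have "?P {R. \<mu> / 2 \<le> real (card (cliques {..<N} (?E \<union> R) 3))}
      \<le> (\<Sum>S | S \<subseteq> {..<N} \<and> card S = 3. p n ^ card (all_edges S - {})) / (\<mu> / 2)"
      by (rule prob_many_cliques_le) (use Nn p0 b0 b\<mu> perturbation_base_Int in auto)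
    also have "(\<Sum>S | S \<subseteq> {..<N} \<and> card S = 3. p n ^ card (all_edges S - {})) =
        (\<Sum>S | S \<subseteq> {..<N} \<and> card S = 3. p n ^ 3)"
    proof (rule sum.cong)
      fix S assume "S \<in> {S. S \<subseteq> {..<N} \<and> card S = 3}"
      then show "p n ^ card (all_edges S - {}) = p n ^ 3"
        by (simp add: card_all_edges finite_subset[of S "{..<N}"] choose_two)
    qed simp
    also have "\<dots> = real (N choose 3) * p n ^ 3" by (simp add: n_subsets)
    also have "\<dots> / (\<mu> / 2) \<le> (real n * p n) ^ 3 / (b n / 2)"
    proof (rule frac_le)
      have "N choose 3 \<le> n ^ 3"
        using binomial_le_power[of N 3] power_mono[OF Nn, of 3] by linarith
      then have "real (N choose 3) \<le> real n ^ 3" by (metis of_nat_le_iff of_nat_power)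
      then show "real (N choose 3) * p n ^ 3 \<le> (real n * p n) ^ 3"
        unfolding power_mult_distrib using p0 by (intro mult_right_mono) auto
    qed (use p0 b0 b\<mu> in auto)
    finally have tri: "?P {R. \<mu> / 2 \<le> real (card (cliques {..<N} (?E \<union> R) 3))}
        \<le> (real n * p n) ^ 3 / (b n / 2)" .
    \<comment> \<open>A factor needs at least as many triangles as isolated vertices
      (\<open>t = 0\<close>), so both counts cannot lie on the typical side of
      \<open>\<mu> / 2\<close>.\<close>
    have "{R. has_clique_factor {..<n} (?E \<union> R) r} \<subseteq>
        {R. real (card (isolated {..<N} (?E \<union> R))) \<le> \<mu> / 2} \<union>
        {R. \<mu> / 2 \<le> real (card (cliques {..<N} (?E \<union> R) 3))}"
      using clique_factor_perturbation_subset[OF n N Nn, of ?E] r by fastforce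
    then have "?P {R. has_clique_factor {..<n} (?E \<union> R) r} \<le>
        ?P ({R. real (card (isolated {..<N} (?E \<union> R))) \<le> \<mu> / 2} \<union>
        {R. \<mu> / 2 \<le> real (card (cliques {..<N} (?E \<union> R) 3))})"
      by (intro measure_pmf.finite_measure_mono) auto
    also have "\<dots> \<le> ?P {R. real (card (isolated {..<N} (?E \<union> R))) \<le> \<mu> / 2} +
        ?P {R. \<mu> / 2 \<le> real (card (cliques {..<N} (?E \<union> R) 3))}"
      by (rule measure_Un_le) auto
    also have "\<dots> < \<epsilon>" using isol tri small(1) by linarith
    finally show "\<exists>(V :: nat set) E. simple_graph V E \<and> card V = n \<and>
       real (min_degree V E) \<ge> (1 - real 2 / real r) * real n \<and>
       measure_pmf.prob (binomial_random_graph V (1/8 * p_fun 2 n))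
         {R. has_clique_factor V (E \<union> R) r} < \<epsilon>"
      unfolding p_def[symmetric] by (intro exists_graphI[OF simple n r deg])
  qed simp
qed

theorem theorem1p3:
  fixes r s :: nat and \<epsilon> :: real
  assumes "1 < s" and "s < r" and "\<epsilon> > 0"
  shows "\<exists>c>0. \<exists>N. \<forall>n\<ge>N. r dvd n \<longrightarrow>
    (\<exists>(V :: nat set) E. simple_graph V E \<and> card V = n \<and>
       real (min_degree V E) \<ge> (1 - real s / real r) * real n \<and>
       measure_pmf.prob (binomial_random_graph V (c * p_fun s n))
         {R. has_clique_factor V (E \<union> R) r} < \<epsilon>)"
proof (cases "s = 2")
  case True
  then show ?thesis using theorem1p3_2 assms by simp
next
  case False
  then show ?thesis using assms by (intro theorem1p3_ge_3) auto
qed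

end
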